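(* Let $n,r\ge 1$ be integers and let $A,B,C_1,\dots,C_n$ be matrices in $\mathbb{C}^{r\times r}$ such that $C_i+kI$ is invertible for all $1\le i\le n$ and all integers $k\ge 0$, and such that $C_iC_j=C_jC_i$ and $C_jB=BC_j$ for all $i,j=1,\dots,n$. Then the matrix function $U=F_{\mathcal{C}}[A,B;C_1,\dots,C_n;x_1,\dots,x_n]$ satisfies, on the interior of the region of absolute convergence of its defining series, the system of partial matrix differential equations $$x_i(1-x_i)\,U_{x_ix_i}-\sum_{\substack{j=1\\ j\ne i}}^{n} x_j^2\,U_{x_jx_j}-2\sum_{1\le p<q\le n}x_px_q\,U_{x_px_q}-(A+I)\sum_{j=1}^{n}x_jU_{x_j}+U_{x_i}C_i-\Big(\sum_{j=1}^{n}x_jU_{x_j}\Big)B-A\,U\,B=0,$$ for $i=1,\dots,n$.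
   Context: For $M\in\mathbb{C}^{r\times r}$, the Pochhammer symbol is $(M)_0=I$ and $(M)_k=M(M+I)\cdots(M+(k-1)I)$ for $k\ge1$; $(M)_k^{-1}$ denotes the inverse matrix of $(M)_k$. Matrix products are taken in the written order. For complex variables $x_1,\dots,x_n$, $$F_{\mathcal{C}}[A,B;C_1,\dots,C_n;x_1,\dots,x_n]=\sum_{m_1,\dots,m_n=0}^{\infty}(A)_{m_1+\cdots+m_n}(B)_{m_1+\cdots+m_n}(C_1)_{m_1}^{-1}\cdots(C_n)_{m_n}^{-1}\,\frac{x_1^{m_1}\cdots x_n^{m_n}}{m_1!\cdots m_n!}.$$ Subscripts denote partial derivatives: $U_{x_i}=\partial U/\partial x_i$, $U_{x_ix_j}=\partial^2U/\partial x_i\partial x_j$. *)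

theory Defs
  imports "HOL-Analysis.Analysis"
begin

text \<open>
  The size \<open>r\<close> of the matrices is the cardinality of the finite index type \<open>'r\<close>, the number \<open>n\<close> of
  variables that of the finite linearly ordered index type \<open>'n\<close>, which plays the role of
  \<open>{1, \<dots>, n}\<close>. The order is used in products over the variables, taken in the written order, and in
  sums over pairs \<open>p < q\<close>. For every \<open>n \<ge> 1\<close> there is such a type (the numeral types). The scalar
  matrix \<open>c I\<close> is \<open>mat c\<close>.
\<close>

text \<open>The library's scalar multiplications on matrices only cover real scalars.\<close>

definition cscale_mat :: "complex \<Rightarrow> complex^'r^'r \<Rightarrow> complex^'r^'r"  (infixr \<open>*\<^sub>C\<close> 75) where
  "c *\<^sub>C M = (\<chi> a b. c * M $ a $ b)"

primrec mat_pochhammer :: "complex^'r^'r \<Rightarrow> nat \<Rightarrow> complex^'r^'r" where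
  "mat_pochhammer M 0 = mat 1"
| "mat_pochhammer M (Suc k) = mat_pochhammer M k ** (M + mat (of_nat k))"

definition ordered_mat_prod ::
    "('n::{finite,linorder} \<Rightarrow> complex^'r^'r) \<Rightarrow> complex^'r^'r" where
  "ordered_mat_prod M = foldr (\<lambda>i P. M i ** P) (sorted_list_of_set UNIV) (mat 1)"

definition F_C_term ::
    "complex^'r^'r \<Rightarrow> complex^'r^'r \<Rightarrow> ('n::{finite,linorder} \<Rightarrow> complex^'r^'r)
      \<Rightarrow> complex^('n::{finite,linorder}) \<Rightarrow> ('n \<Rightarrow> nat) \<Rightarrow> complex^'r^'r" where
  "F_C_term A B C x m =
    (\<Prod>i\<in>UNIV. x $ i ^ m i / fact (m i)) *\<^sub>C
      (mat_pochhammer A (\<Sum>i\<in>UNIV. m i) ** mat_pochhammer B (\<Sum>i\<in>UNIV. m i)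
        ** ordered_mat_prod (\<lambda>i. matrix_inv (mat_pochhammer (C i) (m i))))"

definition F_C ::
    "complex^'r^'r \<Rightarrow> complex^'r^'r \<Rightarrow> ('n::{finite,linorder} \<Rightarrow> complex^'r^'r)
      \<Rightarrow> complex^('n::{finite,linorder}) \<Rightarrow> complex^'r^'r" where
  "F_C A B C x = (\<Sum>\<^sub>\<infinity>m\<in>UNIV. F_C_term A B C x m)"

text \<open>The norm is the Frobenius norm; any other matrix norm gives the same region.\<close>

definition F_C_abs_conv_region ::
    "complex^'r^'r \<Rightarrow> complex^'r^'r \<Rightarrow> ('n::{finite,linorder} \<Rightarrow> complex^'r^'r)
      \<Rightarrow> (complex^('n::{finite,linorder})) set" where
  "F_C_abs_conv_region A B C = {x. (\<lambda>m. norm (F_C_term A B C x m)) summable_on UNIV}"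

text \<open>
  Complex partial derivatives of matrix functions are taken entrywise. As \<open>deriv\<close> is a total
  operator, existence of the derivative is a separate predicate.
\<close>

definition vec_upd :: "complex^'n \<Rightarrow> 'n \<Rightarrow> complex \<Rightarrow> complex^'n" where
  "vec_upd x i z = (\<chi> k. if k = i then z else x $ k)"

definition partially_differentiable ::
    "'n \<Rightarrow> (complex^'n \<Rightarrow> complex^'r^'r) \<Rightarrow> complex^'n \<Rightarrow> bool" where
  "partially_differentiable i U x \<longleftrightarrow>
    (\<forall>a b. (\<lambda>z. U (vec_upd x i z) $ a $ b) field_differentiable at (x $ i))"

definition partial_deriv ::
    "'n \<Rightarrow> (complex^'n \<Rightarrow> complex^'r^'r) \<Rightarrow> complex^'n \<Rightarrow> complex^'r^'r" where
  "partial_deriv i U x = (\<chi> a b. deriv (\<lambda>z. U (vec_upd x i z) $ a $ b) (x $ i))"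

definition partial_deriv2 ::
    "'n \<Rightarrow> 'n \<Rightarrow> (complex^'n \<Rightarrow> complex^'r^'r) \<Rightarrow> complex^'n \<Rightarrow> complex^'r^'r" where
  "partial_deriv2 i j U = partial_deriv i (partial_deriv j U)"

end

theory Submission
  imports Defs "HOL-Complex_Analysis.Cauchy_Integral_Formula"
begin

text \<open>
  Let \<open>T(m)\<close> be the matrix coefficient of \<open>x\<^sup>m\<close> in the series, factorials included, and let
  \<open>N = m\<^sub>1 + \<dots> + m\<^sub>n\<close>. The differential equation compares coefficients in the recurrence

    \<open>(m\<^sub>i + 1) T(m + e\<^sub>i) (C\<^sub>i + m\<^sub>i) = (A + N) T(m) (B + N)\<close>

  (\<open>F_C_coeff_bump\<close>), which follows from the product form of \<open>T\<close> by moving factors past each other;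
  this is where the commutation hypotheses enter. Indeed, with the Euler operator
  \<open>\<theta> = \<Sum>\<^sub>j x\<^sub>j \<partial>/\<partial>x\<^sub>j\<close>, which multiplies the term of index \<open>m\<close> by \<open>N\<close>, the equation says

    \<open>x\<^sub>i U\<^sub>i\<^sub>i + U\<^sub>i C\<^sub>i = \<theta> (\<theta> - 1) U + (A + I) \<theta> U + (\<theta> U) B + A U B\<close>,

  where \<open>U\<^sub>i = \<partial>U/\<partial>x\<^sub>i\<close> and \<open>U\<^sub>i\<^sub>i = \<partial>\<^sup>2U/\<partial>x\<^sub>i\<^sup>2\<close>.
  The left side has the coefficients \<open>(m\<^sub>i + 1) T(m + e\<^sub>i) (C\<^sub>i + m\<^sub>i)\<close>, and on the right side
  \<open>N (N - 1) T + (A + I) N T + N T B + A T B = (A + N) T (B + N)\<close>.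

  The analytic part justifies the termwise differentiation. An interior point of the region of
  absolute convergence lies in an open polydisc on which the series converges
  (\<open>interior_F_C_abs_conv_region_polydisc\<close>). A power series on a polydisc may be differentiated
  termwise in each variable, and the derived series converges on the same polydisc (\<open>power_series_on_partial_deriv\<close>), so this
  can be repeated for the second derivatives. All sums are unordered sums over the multi-indices,
  and two series with equal terms have equal sums.
\<close>

section \<open>Monomials and termwise differentiation\<close>

definition monomial :: "complex^'n \<Rightarrow> ('n \<Rightarrow> nat) \<Rightarrow> complex" where
  "monomial x m = (\<Prod>i\<in>UNIV. x $ i ^ m i)"

definition polydisc :: "('n \<Rightarrow> real) \<Rightarrow> (complex^'n) set" where
  "polydisc \<rho> = {x. \<forall>i. norm (x $ i) < \<rho> i}"

text \<open>
The index \<open>m + e\<^sub>i\<close>. Differentiating by \<open>x\<^sub>i\<close> or multiplying by \<open>x\<^sub>i\<close> shifts a series along this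
injection, whose range misses exactly the indices with \<open>m\<^sub>i = 0\<close>.
\<close>
definition bump :: "'n \<Rightarrow> ('n \<Rightarrow> nat) \<Rightarrow> 'n \<Rightarrow> nat" where
  "bump i m = m(i := Suc (m i))"

lemma bump_apply: "bump i m j = (if j = i then Suc (m i) else m j)"
  by (simp add: bump_def)

lemma inj_bump: "inj (bump i)"
  by (rule injI) (metis bump_apply ext nat.inject)

lemma range_bump: "range (bump i) = {m. m i \<noteq> 0}"
proof -
  have "m = bump i (m(i := m i - 1))" if "m i \<noteq> 0" for m
    using that by (auto simp: bump_def fun_eq_iff)
  then show ?thesis by (auto simp: bump_apply)
qed

lemma monomial_vec_upd:
  fixes x :: "complex^'n"
  shows "monomial (vec_upd x i z) m = z ^ m i * (\<Prod>j\<in>UNIV - {i}. x $ j ^ m j)"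
  unfolding monomial_def by (subst prod.remove[of _ i]) (auto simp: vec_upd_def)

lemma vec_upd_same: "vec_upd x i (x $ i) = x"
  by (simp add: vec_upd_def vec_eq_iff)

lemma monomial_split:
  fixes x :: "complex^'n"
  shows "monomial x m = x $ i ^ m i * (\<Prod>j\<in>UNIV - {i}. x $ j ^ m j)"
  using monomial_vec_upd[of x i "x $ i" m] by (simp add: vec_upd_same)

lemma monomial_bump:
  fixes x :: "complex^'n"
  shows "monomial x (bump i m) = x $ i * monomial x m"
  by (simp add: monomial_split[of x _ i] bump_apply)

lemma norm_monomial_mono:
  assumes "\<And>i. norm (x $ i) \<le> norm (y $ i)"
  shows "norm (monomial x m) \<le> norm (monomial y m)"
  unfolding monomial_def prod_norm[symmetric] norm_power
  by (intro prod_mono conjI power_mono assms zero_le_power norm_ge_zero)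

text \<open>
The Weierstrass M-test along the net of finite partial sums: the error of a partial sum is at most
the tail of the majorant, which does not depend on \<open>w\<close>.
\<close>
lemma uniform_limit_has_sum:
  fixes g :: "'a \<Rightarrow> 'b \<Rightarrow> complex"
  assumes sum: "\<And>w. w \<in> S \<Longrightarrow> ((\<lambda>m. g m w) has_sum f w) UNIV"
    and M: "M summable_on UNIV"
    and le: "\<And>m w. w \<in> S \<Longrightarrow> norm (g m w) \<le> M m"
  shows "uniform_limit S (\<lambda>F w. \<Sum>m\<in>F. g m w) f (finite_subsets_at_top UNIV)"
proof (rule uniform_limitI)
  fix e :: real assume "e > 0"
  have "(sum M \<longlongrightarrow> infsum M UNIV) (finite_subsets_at_top UNIV)"
    using M has_sum_def has_sum_infsum by blast
  then have "\<forall>\<^sub>F F in finite_subsets_at_top UNIV. dist (sum M F) (infsum M UNIV) < e"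
    using \<open>e > 0\<close> by (rule tendstoD)
  moreover have "\<forall>\<^sub>F F in finite_subsets_at_top (UNIV :: 'a set). finite F"
    by (rule eventually_finite_subsets_at_top_weakI)
  ultimately show "\<forall>\<^sub>F F in finite_subsets_at_top UNIV. \<forall>w\<in>S. dist (\<Sum>m\<in>F. g m w) (f w) < e"
  proof eventually_elim
    case (elim F)
    show ?case
    proof
      fix w assume w: "w \<in> S"
      have tail: "((\<lambda>m. g m w) has_sum (f w - (\<Sum>m\<in>F. g m w))) (UNIV - F)"
        by (rule has_sum_Diff[OF sum[OF w]]) (use elim(2) in auto)
      have tailM: "(M has_sum (infsum M UNIV - sum M F)) (UNIV - F)"
        by (rule has_sum_Diff) (use elim(2) M in auto)
      have "norm (f w - (\<Sum>m\<in>F. g m w)) \<le> infsum M UNIV - sum M F"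
        by (rule norm_infsum_le[OF tail tailM]) (use le[OF w] in auto)
      also have "\<dots> < e" using elim(1) by (simp add: dist_real_def)
      finally show "dist (\<Sum>m\<in>F. g m w) (f w) < e" by (simp add: dist_norm norm_minus_commute)
    qed
  qed
qed

lemma has_sum_bump_neutral:
  assumes "\<And>m. m i = 0 \<Longrightarrow> f m = 0"
  shows "((\<lambda>m. f (bump i m)) has_sum s) UNIV \<longleftrightarrow> (f has_sum s) UNIV"
proof -
  have "((\<lambda>m. f (bump i m)) has_sum s) UNIV \<longleftrightarrow> (f has_sum s) (range (bump i))"
    by (simp add: has_sum_reindex[OF inj_bump] o_def)
  also have "\<dots> \<longleftrightarrow> (f has_sum s) UNIV"
    by (rule has_sum_cong_neutral) (auto simp: range_bump assms)
  finally show ?thesis .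
qed

text \<open>
The partial sums are polynomials in \<open>x\<^sub>i\<close> and converge uniformly on a small closed disc around the
given value, so Weierstrass's theorem on uniform limits of holomorphic functions differentiates the
series termwise. It needs a majorant that is independent of the point of the disc: the absolute
values of the terms at a single point \<open>y\<close> of the polydisc whose \<open>i\<close>-th coordinate has the largest
modulus in that disc. These are summable because unordered summability of complex numbers is absolute
summability. The differentiated series converges on the same open polydisc, hence the argument can be
iterated.
\<close>
lemma power_series_termwise_partial_deriv:
  fixes c :: "('n::finite \<Rightarrow> nat) \<Rightarrow> complex"
  assumes sum: "\<And>w. w \<in> polydisc \<rho> \<Longrightarrow> ((\<lambda>m. monomial w m * c m) has_sum f w) UNIV"
    and x: "x \<in> polydisc \<rho>"
  obtains f' where "((\<lambda>z. f (vec_upd x i z)) has_field_derivative f') (at (x $ i))"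
    and "((\<lambda>m. monomial x m * (of_nat (Suc (m i)) * c (bump i m))) has_sum f') UNIV"
proof -
  \<comment> \<open>Half the distance to the boundary, so that the closed disc stays inside the polydisc.\<close>
  define r where "r = (\<rho> i - norm (x $ i)) / 2"
  define y where "y = vec_upd x i (of_real (norm (x $ i) + r))"
  define P where "P = (\<lambda>m. (\<Prod>j\<in>UNIV - {i}. x $ j ^ m j))"
  define g where "g = (\<lambda>m z. monomial (vec_upd x i z) m * c m)"
  define g' where "g' = (\<lambda>m z. of_nat (m i) * z ^ (m i - 1) * P m * c m)"
  have g_eq: "g m z = z ^ m i * (P m * c m)" for m z
    by (simp add: g_def P_def monomial_vec_upd)
  have xi: "norm (x $ i) < \<rho> i" using x by (simp add: polydisc_def)
  then have r: "r > 0" "norm (x $ i) + r < \<rho> i" by (auto simp: r_def field_simps)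
  have nz: "norm z \<le> norm (x $ i) + r" if "z \<in> cball (x $ i) r" for z
    using that norm_triangle_sub[of z "x $ i"] by (simp add: dist_norm norm_minus_commute)
  have yi: "y $ i = of_real (norm (x $ i) + r)" by (simp add: y_def vec_upd_def)
  have ynorm: "norm (y $ i) = norm (x $ i) + r" unfolding yi norm_of_real using r by simp
  have y: "y \<in> polydisc \<rho>"
    using x r ynorm unfolding polydisc_def
    by (auto simp: y_def vec_upd_def)
  have upd_in: "vec_upd x i z \<in> polydisc \<rho>" if "z \<in> cball (x $ i) r" for z
    using x nz[OF that] r by (auto simp: polydisc_def vec_upd_def)
  have M: "(\<lambda>m. norm (monomial y m * c m)) summable_on UNIV"
    by (rule summable_on_iff_abs_summable_on_complex[THEN iffD1, OF has_sum_imp_summable[OF sum[OF y]]])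
  have le: "norm (g m z) \<le> norm (monomial y m * c m)" if "z \<in> cball (x $ i) r" for m z
  proof -
    have "norm (monomial (vec_upd x i z) m) \<le> norm (monomial y m)"
    proof (rule norm_monomial_mono)
      fix j show "norm (vec_upd x i z $ j) \<le> norm (y $ j)"
        using nz[OF that] ynorm by (cases "j = i") (auto simp: vec_upd_def y_def)
    qed
    then show ?thesis by (simp add: g_def norm_mult mult_right_mono)
  qed
  have ulim: "uniform_limit (cball (x $ i) r) (\<lambda>F z. \<Sum>m\<in>F. g m z) (\<lambda>z. f (vec_upd x i z))
      (finite_subsets_at_top UNIV)"
    by (rule uniform_limit_has_sum[OF _ M le]) (simp_all add: g_def sum upd_in del: mem_cball)
  have der: "(g m has_field_derivative g' m z) (at z)" for m z
    unfolding g_eq g'_def by (auto intro!: derivative_eq_intros)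
  have ders: "((\<lambda>z. \<Sum>m\<in>F. g m z) has_field_derivative (\<Sum>m\<in>F. g' m z)) (at z)" for F z
    by (rule DERIV_sum) (rule der)
  have cont: "\<forall>\<^sub>F F in finite_subsets_at_top UNIV. continuous_on (cball (x $ i) r) (\<lambda>z. \<Sum>m\<in>F. g m z) \<and>
      (\<forall>z\<in>ball (x $ i) r. ((\<lambda>z. \<Sum>m\<in>F. g m z) has_field_derivative (\<Sum>m\<in>F. g' m z)) (at z))"
    using ders by (intro always_eventually allI conjI ballI)
      (auto intro!: continuous_at_imp_continuous_on DERIV_isCont)
  obtain f' where f': "\<And>z. z \<in> ball (x $ i) r \<Longrightarrow> ((\<lambda>z. f (vec_upd x i z)) has_field_derivative f' z) (at z) \<and>
      ((\<lambda>F. \<Sum>m\<in>F. g' m z) \<longlongrightarrow> f' z) (finite_subsets_at_top UNIV)"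
    using has_complex_derivative_uniform_limit[OF cont ulim _ r(1)] by auto
  have "((\<lambda>m. g' m (x $ i)) has_sum f' (x $ i)) UNIV"
    using f'[of "x $ i"] r by (simp add: has_sum_def)
  \<comment> \<open>The terms with \<open>m i = 0\<close> are constant in \<open>z\<close>; dropping them moves the index by \<open>e\<^sub>i\<close>.\<close>
  then have "((\<lambda>m. g' (bump i m) (x $ i)) has_sum f' (x $ i)) UNIV"
    by (subst has_sum_bump_neutral[where f = "\<lambda>m. g' m (x $ i)"]) (auto simp: g'_def)
  moreover have "g' (bump i m) (x $ i) = monomial x m * (of_nat (Suc (m i)) * c (bump i m))" for m
    by (simp add: g'_def P_def bump_apply monomial_split[of x m i])
  ultimately have "((\<lambda>m. monomial x m * (of_nat (Suc (m i)) * c (bump i m))) has_sum f' (x $ i)) UNIV"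
    by simp
  then show ?thesis using that f'[of "x $ i"] r by auto
qed

section \<open>Complex scaling and entrywise sums of matrices\<close>

lemma cscale_nth: "(c *\<^sub>C M) $ a $ b = c * M $ a $ b"
  by (simp add: cscale_mat_def)

lemma cscale_algebra:
  "c *\<^sub>C (M + N) = c *\<^sub>C M + c *\<^sub>C N"
  "c *\<^sub>C (M - N) = c *\<^sub>C M - c *\<^sub>C N"
  "(c + d) *\<^sub>C M = c *\<^sub>C M + d *\<^sub>C M"
  "(c - d) *\<^sub>C M = c *\<^sub>C M - d *\<^sub>C M"
  "c *\<^sub>C d *\<^sub>C M = (c * d) *\<^sub>C M"
  "1 *\<^sub>C M = M" "0 *\<^sub>C M = 0" "c *\<^sub>C (0 :: complex^'r^'r) = 0"
  by (simp_all add: vec_eq_iff cscale_nth algebra_simps)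

lemma cscale_sum: "c *\<^sub>C (\<Sum>k\<in>K. M k) = (\<Sum>k\<in>K. c *\<^sub>C M k)"
  by (simp add: vec_eq_iff cscale_nth sum_distrib_left)

lemma sum_cscale: "(\<Sum>k\<in>K. f k) *\<^sub>C M = (\<Sum>k\<in>K. f k *\<^sub>C M)"
  by (simp add: vec_eq_iff cscale_nth sum_distrib_right)

lemma cscale_mult:
  "(c *\<^sub>C M) ** N = c *\<^sub>C (M ** N)"
  "M ** (c *\<^sub>C N) = c *\<^sub>C (M ** N)"
  by (simp_all add: vec_eq_iff cscale_nth matrix_matrix_mult_def sum_distrib_left mult_ac)

lemma mult_mat_scalar:
  fixes M :: "complex^'r^'r"
  shows "mat c ** M = c *\<^sub>C M" and "M ** mat c = c *\<^sub>C M"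
proof -
  have "mat c = c *\<^sub>C (mat 1 :: complex^'r^'r)"
    by (simp add: vec_eq_iff cscale_nth mat_def)
  then show "mat c ** M = c *\<^sub>C M" "M ** mat c = c *\<^sub>C M"
    by (simp_all add: cscale_mult)
qed

lemma bounded_linear_matrix_ops:
  fixes M :: "complex^'r^'r"
  shows "bounded_linear (\<lambda>X :: complex^'r^'r. c *\<^sub>C X)"
    and "bounded_linear (\<lambda>X :: complex^'r^'r. M ** X)"
    and "bounded_linear (\<lambda>X :: complex^'r^'r. X ** M)"
  unfolding linear_conv_bounded_linear[symmetric]
  by (rule linearI; simp add: vec_eq_iff cscale_nth matrix_matrix_mult_def algebra_simps
        sum.distrib scaleR_sum_right)+

lemma bounded_linear_entry: "bounded_linear (\<lambda>X :: complex^'r^'r. X $ a $ b)"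
  by (intro bounded_linear_compose[OF bounded_linear_vec_nth bounded_linear_vec_nth])

lemma has_sum_matrix_iff:
  fixes T :: "'a \<Rightarrow> complex^'r^'r"
  shows "(T has_sum S) UNIV \<longleftrightarrow> (\<forall>a b. ((\<lambda>m. T m $ a $ b) has_sum S $ a $ b) UNIV)"
proof
  assume "(T has_sum S) UNIV"
  then show "\<forall>a b. ((\<lambda>m. T m $ a $ b) has_sum S $ a $ b) UNIV"
    using has_sum_bounded_linear[OF bounded_linear_entry] by blast
next
  assume *: "\<forall>a b. ((\<lambda>m. T m $ a $ b) has_sum S $ a $ b) UNIV"
  show "(T has_sum S) UNIV"
    unfolding has_sum_def
    by (intro vec_tendstoI) (use * in \<open>simp add: has_sum_def\<close>)
qed

section \<open>Partial derivatives of matrix power series\<close>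

text \<open>
The sum function \<open>U\<close> is a parameter and not the infinite sum itself, so that \<open>partial_deriv i U\<close> can
again take its place.
\<close>
definition power_series_on ::
    "('n \<Rightarrow> real) \<Rightarrow> (('n::finite \<Rightarrow> nat) \<Rightarrow> complex^'r^'r) \<Rightarrow> (complex^'n \<Rightarrow> complex^'r^'r) \<Rightarrow> bool" where
  "power_series_on \<rho> T U \<longleftrightarrow>
    (\<forall>x\<in>polydisc \<rho>. ((\<lambda>m. monomial x m *\<^sub>C T m) has_sum U x) UNIV)"

definition pderiv_coeff ::
    "'n \<Rightarrow> (('n \<Rightarrow> nat) \<Rightarrow> complex^'r^'r) \<Rightarrow> ('n \<Rightarrow> nat) \<Rightarrow> complex^'r^'r" where
  "pderiv_coeff i T m = of_nat (Suc (m i)) *\<^sub>C T (bump i m)"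

lemma power_series_on_partial_deriv:
  assumes "power_series_on \<rho> T U"
  shows "x \<in> polydisc \<rho> \<Longrightarrow> partially_differentiable i U x"
    and "power_series_on \<rho> (pderiv_coeff i T) (partial_deriv i U)"
proof -
  have entry: "((\<lambda>z. U (vec_upd x i z) $ a $ b) has_field_derivative partial_deriv i U x $ a $ b) (at (x $ i)) \<and>
      ((\<lambda>m. (monomial x m *\<^sub>C pderiv_coeff i T m) $ a $ b) has_sum partial_deriv i U x $ a $ b) UNIV"
    if x: "x \<in> polydisc \<rho>" for x a b
  proof -
    have sum: "((\<lambda>m. monomial w m * T m $ a $ b) has_sum U w $ a $ b) UNIV" if "w \<in> polydisc \<rho>" for w
      using assms that by (simp add: power_series_on_def has_sum_matrix_iff cscale_nth)
    obtain f' where f': "((\<lambda>z. U (vec_upd x i z) $ a $ b) has_field_derivative f') (at (x $ i))"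
      "((\<lambda>m. monomial x m * (of_nat (Suc (m i)) * T (bump i m) $ a $ b)) has_sum f') UNIV"
      by (rule power_series_termwise_partial_deriv[where c = "\<lambda>m. T m $ a $ b" and f = "\<lambda>w. U w $ a $ b",
            OF sum x])
    moreover have "partial_deriv i U x $ a $ b = f'"
      using f'(1) by (simp add: partial_deriv_def DERIV_imp_deriv)
    ultimately show ?thesis by (simp add: pderiv_coeff_def cscale_nth)
  qed
  show "x \<in> polydisc \<rho> \<Longrightarrow> partially_differentiable i U x"
    using entry by (auto simp: partially_differentiable_def field_differentiable_def)
  show "power_series_on \<rho> (pderiv_coeff i T) (partial_deriv i U)"
    using entry by (auto simp: power_series_on_def has_sum_matrix_iff)
qed

text \<open>
Multiplying by \<open>x\<^sub>i\<close> moves the coefficient at \<open>m\<close> to \<open>m + e\<^sub>i\<close>. This returns every term of the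
differential equation to the monomials of the original series.
\<close>
lemma has_sum_monomial_shift:
  assumes "((\<lambda>m. monomial x m *\<^sub>C S m) has_sum V) UNIV"
    and "\<And>m. m i = 0 \<Longrightarrow> R m = 0" and "\<And>m. R (bump i m) = S m"
  shows "((\<lambda>m. monomial x m *\<^sub>C R m) has_sum x $ i *\<^sub>C V) UNIV"
proof -
  have "((\<lambda>m. x $ i *\<^sub>C monomial x m *\<^sub>C S m) has_sum x $ i *\<^sub>C V) UNIV"
    by (rule has_sum_bounded_linear[OF bounded_linear_matrix_ops(1) assms(1)])
  then have "((\<lambda>m. monomial x (bump i m) *\<^sub>C R (bump i m)) has_sum x $ i *\<^sub>C V) UNIV"
    by (simp add: monomial_bump cscale_algebra assms(3))
  then show ?thesis
    by (subst (asm) has_sum_bump_neutral) (auto simp: assms(2) cscale_algebra)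
qed

lemma has_sum_x_partial_deriv:
  assumes "power_series_on \<rho> T U" "x \<in> polydisc \<rho>"
  shows "((\<lambda>m. monomial x m *\<^sub>C (of_nat (m i) *\<^sub>C T m)) has_sum x $ i *\<^sub>C partial_deriv i U x) UNIV"
proof (rule has_sum_monomial_shift)
  show "((\<lambda>m. monomial x m *\<^sub>C pderiv_coeff i T m) has_sum partial_deriv i U x) UNIV"
    using power_series_on_partial_deriv(2)[OF assms(1)] assms(2)
    unfolding power_series_on_def by blast
qed (auto simp: pderiv_coeff_def bump_apply cscale_algebra)

text \<open>
Applying \<open>\<partial>/\<partial>x\<^sub>q\<close>, then \<open>x\<^sub>p \<partial>/\<partial>x\<^sub>p\<close>, then multiplication by \<open>x\<^sub>q\<close> gives the factor \<open>m\<^sub>p m\<^sub>q\<close>; for \<open>p = q\<close>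
the exponent has already dropped by one when the second derivative is taken, and the factor is
\<open>m\<^sub>p (m\<^sub>p - 1)\<close>.
\<close>
lemma has_sum_xx_partial_deriv2:
  assumes "power_series_on \<rho> T U" "x \<in> polydisc \<rho>"
  shows "((\<lambda>m. monomial x m *\<^sub>C
      ((of_nat (m p) * of_nat (m q) - (if p = q then of_nat (m p) else 0)) *\<^sub>C T m))
    has_sum (x $ p * x $ q) *\<^sub>C partial_deriv2 p q U x) UNIV"
proof -
  have "((\<lambda>m. monomial x m *\<^sub>C (of_nat (m p) *\<^sub>C pderiv_coeff q T m))
      has_sum x $ p *\<^sub>C partial_deriv2 p q U x) UNIV"
    unfolding partial_deriv2_def
    by (rule has_sum_x_partial_deriv[OF power_series_on_partial_deriv(2)[OF assms(1)] assms(2)])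
  then have "((\<lambda>m. monomial x m *\<^sub>C
      ((of_nat (m p) * of_nat (m q) - (if p = q then of_nat (m p) else 0)) *\<^sub>C T m))
      has_sum x $ q *\<^sub>C x $ p *\<^sub>C partial_deriv2 p q U x) UNIV"
    by (rule has_sum_monomial_shift)
       (auto simp: pderiv_coeff_def bump_apply cscale_algebra algebra_simps)
  then show ?thesis by (simp add: cscale_algebra mult.commute)
qed

section \<open>The Euler operator\<close>

lemma total_degree_square:
  fixes m :: "'n::{finite,linorder} \<Rightarrow> nat"
  defines "N \<equiv> \<Sum>j\<in>UNIV. m j"
  shows "(\<Sum>j\<in>UNIV. of_nat (m j) * of_nat (m j)) + 2 * (\<Sum>(p, q)\<in>{(p, q). p < q}. of_nat (m p) * of_nat (m q))
    = (of_nat N * of_nat N :: complex)"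
proof -
  let ?f = "\<lambda>(p, q). of_nat (m p) * of_nat (m q) :: complex"
  have "(of_nat N * of_nat N :: complex) = (\<Sum>z\<in>UNIV \<times> UNIV. ?f z)"
    by (simp add: N_def sum_product sum.cartesian_product)
  also have "UNIV \<times> UNIV = {(p, q :: 'n). p = q} \<union> ({(p, q). p < q} \<union> {(p, q). q < p})"
    by auto
  also have "sum ?f \<dots> = sum ?f {(p, q). p = q} + (sum ?f {(p, q). p < q} + sum ?f {(p, q). q < p})"
    by (subst sum.union_disjoint, auto)+
  also have "sum ?f {(p, q). q < p} = sum ?f {(p, q). p < q}"
    by (rule sum.reindex_bij_witness[of _ prod.swap prod.swap]) auto
  also have "sum ?f {(p, q). p = q} = (\<Sum>j\<in>UNIV. of_nat (m j) * of_nat (m j))"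
    by (rule sum.reindex_bij_witness[of _ "\<lambda>j. (j, j)" fst]) auto
  finally show ?thesis by simp
qed

lemma has_sum_finite_sum:
  fixes f :: "'k \<Rightarrow> 'a \<Rightarrow> 'b :: topological_comm_monoid_add"
  assumes "finite K" "\<And>k. k \<in> K \<Longrightarrow> (f k has_sum s k) A"
  shows "((\<lambda>m. \<Sum>k\<in>K. f k m) has_sum (\<Sum>k\<in>K. s k)) A"
  using assms by (induction K) (auto intro: has_sum_add)

lemma has_sum_euler:
  fixes U :: "complex^('n::{finite,linorder}) \<Rightarrow> complex^'r^'r"
  assumes U: "power_series_on \<rho> T U" and x: "x \<in> polydisc \<rho>"
  shows "((\<lambda>m. monomial x m *\<^sub>C (of_nat (\<Sum>j\<in>UNIV. m j) *\<^sub>C T m))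
    has_sum (\<Sum>j\<in>UNIV. x $ j *\<^sub>C partial_deriv j U x)) UNIV"
proof -
  have "((\<lambda>m. \<Sum>j\<in>UNIV. monomial x m *\<^sub>C (of_nat (m j) *\<^sub>C T m))
      has_sum (\<Sum>j\<in>UNIV. x $ j *\<^sub>C partial_deriv j U x)) UNIV"
    by (intro has_sum_finite_sum has_sum_x_partial_deriv[OF U x]) simp
  then show ?thesis by (simp add: cscale_sum sum_cscale)
qed

text \<open>
The second-order part is \<open>\<theta> (\<theta> - 1) U\<close> for the Euler operator \<open>\<theta> = \<Sum>\<^sub>j x\<^sub>j \<partial>/\<partial>x\<^sub>j\<close>, which multiplies the
term of index \<open>m\<close> by its total degree.
\<close>
lemma has_sum_euler2:
  fixes U :: "complex^('n::{finite,linorder}) \<Rightarrow> complex^'r^'r"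
  assumes U: "power_series_on \<rho> T U" and x: "x \<in> polydisc \<rho>"
  shows "((\<lambda>m. monomial x m *\<^sub>C
      ((of_nat (\<Sum>j\<in>UNIV. m j) * of_nat (\<Sum>j\<in>UNIV. m j) - of_nat (\<Sum>j\<in>UNIV. m j)) *\<^sub>C T m))
    has_sum (\<Sum>j\<in>UNIV. (x $ j)\<^sup>2 *\<^sub>C partial_deriv2 j j U x)
      + 2 *\<^sub>C (\<Sum>(p, q)\<in>{(p, q). p < q}. (x $ p * x $ q) *\<^sub>C partial_deriv2 p q U x)) UNIV"
proof -
  let ?d = "\<lambda>m p q. of_nat (m p) * of_nat (m q) - (if p = q then of_nat (m p) else 0) :: complex"
  have diag: "((\<lambda>m. \<Sum>j\<in>UNIV. monomial x m *\<^sub>C (?d m j j *\<^sub>C T m))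
      has_sum (\<Sum>j\<in>UNIV. (x $ j)\<^sup>2 *\<^sub>C partial_deriv2 j j U x)) UNIV"
    unfolding power2_eq_square
    by (intro has_sum_finite_sum has_sum_xx_partial_deriv2[OF U x]) simp
  have "((\<lambda>m. \<Sum>(p, q)\<in>{(p, q). p < q}. monomial x m *\<^sub>C (?d m p q *\<^sub>C T m))
      has_sum (\<Sum>(p, q)\<in>{(p, q). p < q}. (x $ p * x $ q) *\<^sub>C partial_deriv2 p q U x)) UNIV"
    unfolding case_prod_unfold
    by (intro has_sum_finite_sum has_sum_xx_partial_deriv2[OF U x]) simp
  note has_sum_add[OF diag has_sum_bounded_linear[OF bounded_linear_matrix_ops(1)[of 2] this]]
  moreover have "(\<Sum>j\<in>UNIV. monomial x m *\<^sub>C (?d m j j *\<^sub>C T m))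
        + 2 *\<^sub>C (\<Sum>(p, q)\<in>{(p, q). p < q}. monomial x m *\<^sub>C (?d m p q *\<^sub>C T m))
      = monomial x m *\<^sub>C
        ((of_nat (\<Sum>j\<in>UNIV. m j) * of_nat (\<Sum>j\<in>UNIV. m j) - of_nat (\<Sum>j\<in>UNIV. m j)) *\<^sub>C T m)" for m
  proof -
    have "(\<Sum>(p, q)\<in>{(p, q). p < q}. ?d m p q) = (\<Sum>(p, q)\<in>{(p, q). p < q}. of_nat (m p) * of_nat (m q))"
      by (rule sum.cong) auto
    moreover have "(\<Sum>j\<in>UNIV. ?d m j j) = (\<Sum>j\<in>UNIV. of_nat (m j) * of_nat (m j)) - of_nat (\<Sum>j\<in>UNIV. m j)"
      by (simp add: sum_subtractf)
    ultimately have d: "(\<Sum>j\<in>UNIV. ?d m j j) + 2 * (\<Sum>(p, q)\<in>{(p, q). p < q}. ?d m p q)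
        = of_nat (\<Sum>j\<in>UNIV. m j) * of_nat (\<Sum>j\<in>UNIV. m j) - of_nat (\<Sum>j\<in>UNIV. m j)"
      using total_degree_square[of m] by (simp only: diff_add_eq)
    show ?thesis
      unfolding d[symmetric] case_prod_unfold cscale_algebra(3) sum_cscale[symmetric] cscale_sum[symmetric]
      by (simp only: cscale_algebra mult.left_commute[of 2])
  qed
  ultimately show ?thesis by simp
qed

section \<open>Commuting matrices and Pochhammer symbols\<close>

lemma matrix_add_rdistrib: "(M + N) ** P = M ** P + N ** (P :: complex^'r^'r)"
  by (simp add: vec_eq_iff matrix_matrix_mult_def distrib_right sum.distrib)

lemma commute_add_scalar:
  fixes K M :: "complex^'r^'r"
  assumes "K ** M = M ** K"
  shows "K ** (M + mat c) = (M + mat c) ** K"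
  by (simp add: matrix_add_ldistrib matrix_add_rdistrib mult_mat_scalar assms)

lemma commute_mat_mult:
  fixes K M N :: "complex^'r^'r"
  assumes "K ** M = M ** K" "K ** N = N ** K"
  shows "K ** (M ** N) = (M ** N) ** K"
  by (metis assms matrix_mul_assoc)

lemma commute_mat_pochhammer:
  assumes "K ** M = M ** K"
  shows "K ** mat_pochhammer M k = mat_pochhammer M k ** K"
proof (induction k)
  case (Suc k)
  then show ?case
    by (simp only: mat_pochhammer.simps) (intro commute_mat_mult commute_add_scalar assms)
qed simp

lemma matrix_inv_inverse:
  fixes X :: "complex^'r^'r"
  assumes "invertible X"
  shows "X ** matrix_inv X = mat 1" "matrix_inv X ** X = mat 1"
  using someI_ex[OF assms[unfolded invertible_def]] by (simp_all add: matrix_inv_def)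

lemma commute_matrix_inv:
  fixes K X :: "complex^'r^'r"
  assumes "invertible X" "K ** X = X ** K"
  shows "K ** matrix_inv X = matrix_inv X ** K"
proof -
  have "K ** matrix_inv X = matrix_inv X ** X ** K ** matrix_inv X"
    by (simp add: matrix_inv_inverse assms(1))
  also have "\<dots> = matrix_inv X ** (K ** X) ** matrix_inv X"
    by (simp add: assms(2) matrix_mul_assoc)
  also have "\<dots> = matrix_inv X ** K ** (X ** matrix_inv X)"
    by (simp add: matrix_mul_assoc)
  finally show ?thesis by (simp add: matrix_inv_inverse assms(1))
qed

lemma invertible_mat_pochhammer:
  fixes M :: "complex^'r^'r"
  assumes "\<And>k::nat. invertible (M + mat (of_nat k))"
  shows "invertible (mat_pochhammer M k)"
proof (induction k)
  case 0
  then show ?case by (auto simp: invertible_def intro: exI[of _ "mat 1"])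
qed (simp add: invertible_mult assms)

lemma inv_mat_pochhammer_Suc:
  fixes M :: "complex^'r^'r"
  assumes "\<And>k::nat. invertible (M + mat (of_nat k))"
  shows "matrix_inv (mat_pochhammer M (Suc k)) ** (M + mat (of_nat k)) = matrix_inv (mat_pochhammer M k)"
proof -
  let ?P = "mat_pochhammer M"
  have eq: "?P (Suc k) = (M + mat (of_nat k)) ** ?P k"
    using commute_mat_pochhammer[of "M + mat (of_nat k)" M k] commute_add_scalar[of M M "of_nat k"] by simp
  have "matrix_inv (?P (Suc k)) ** (M + mat (of_nat k))
      = matrix_inv (?P (Suc k)) ** ((M + mat (of_nat k)) ** ?P k) ** matrix_inv (?P k)"
    by (simp add: matrix_mul_assoc[symmetric] matrix_inv_inverse invertible_mat_pochhammer assms)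
  also have "\<dots> = matrix_inv (?P k)"
    unfolding eq[symmetric]
    by (simp add: matrix_inv_inverse invertible_mat_pochhammer assms del: mat_pochhammer.simps)
  finally show ?thesis .
qed

lemma commute_foldr_mult:
  fixes K :: "complex^'r^'r"
  assumes "\<And>j. j \<in> set xs \<Longrightarrow> K ** M j = M j ** K"
  shows "K ** foldr (\<lambda>j P. M j ** P) xs (mat 1) = foldr (\<lambda>j P. M j ** P) xs (mat 1) ** K"
  using assms by (induction xs) (simp_all add: commute_mat_mult)

text \<open>
A factor multiplied on the right of an ordered product reaches the \<open>i\<close>-th position because it
commutes with all factors that stand after it.
\<close>
lemma foldr_mult_absorb:
  fixes K :: "complex^'r^'r"
  assumes "distinct xs" "i \<in> set xs" "\<And>j. j \<noteq> i \<Longrightarrow> M' j = M j" "M' i ** K = M i"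
    and "\<And>j. K ** M j = M j ** K"
  shows "foldr (\<lambda>j P. M' j ** P) xs (mat 1) ** K = foldr (\<lambda>j P. M j ** P) xs (mat 1)"
  using assms(1,2)
proof (induction xs)
  case (Cons j xs)
  let ?P = "\<lambda>M. foldr (\<lambda>j P. M j ** P) xs (mat 1)"
  show ?case
  proof (cases "j = i")
    case True
    then have "i \<notin> set xs" using Cons.prems by auto
    then have "?P M' = ?P M"
      by (intro foldr_cong) (metis assms(3))+
    moreover have "M' i ** ?P M ** K = M' i ** K ** ?P M"
      by (metis commute_foldr_mult[of xs K M] assms(5) matrix_mul_assoc)
    ultimately show ?thesis using True by (simp add: assms(4))
  next
    case False
    then show ?thesis
      using Cons by (simp add: assms(3) matrix_mul_assoc[symmetric])
  qed
qed simp

section \<open>The coefficients and their recurrence\<close>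

definition F_C_coeff ::
    "complex^'r^'r \<Rightarrow> complex^'r^'r \<Rightarrow> ('n::{finite,linorder} \<Rightarrow> complex^'r^'r)
      \<Rightarrow> ('n \<Rightarrow> nat) \<Rightarrow> complex^'r^'r" where
  "F_C_coeff A B C m =
    inverse (\<Prod>i\<in>UNIV. fact (m i)) *\<^sub>C
      (mat_pochhammer A (\<Sum>i\<in>UNIV. m i) ** mat_pochhammer B (\<Sum>i\<in>UNIV. m i)
        ** ordered_mat_prod (\<lambda>i. matrix_inv (mat_pochhammer (C i) (m i))))"

lemma F_C_term_eq: "F_C_term A B C x m = monomial x m *\<^sub>C F_C_coeff A B C m"
  by (simp add: F_C_term_def F_C_coeff_def cscale_algebra monomial_def prod_dividef flip: divide_inverse)

lemma sum_bump: "(\<Sum>j\<in>UNIV. bump i m j) = Suc (\<Sum>j\<in>UNIV. m j)" for m :: "'n::finite \<Rightarrow> nat"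
  by (simp add: sum.remove[of UNIV i] bump_apply)

lemma prod_fact_bump:
  fixes m :: "'n::finite \<Rightarrow> nat"
  shows "(\<Prod>j\<in>UNIV. fact (bump i m j) :: complex) = of_nat (Suc (m i)) * (\<Prod>j\<in>UNIV. fact (m j))"
  by (simp add: prod.remove[of UNIV i] bump_apply)

text \<open>
The recurrence between coefficients that the differential equation expresses. Raising \<open>m\<^sub>i\<close>
by one appends the factors \<open>A + N\<close> and \<open>B + N\<close> to the two Pochhammer symbols,
multiplies the factorials by \<open>m\<^sub>i + 1\<close>, which the differentiation cancels, and multiplies the inverse
for \<open>C\<^sub>i\<close> by the inverse of \<open>C\<^sub>i + m\<^sub>i\<close>.
The new factor \<open>A + N\<close> commutes with the Pochhammer symbol of \<open>A\<close> on its left and so moves to the far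
left. The factor \<open>B + N\<close> moves to the far right, because \<open>B\<close> commutes with all \<open>C\<^sub>j\<close>. That \<open>C\<^sub>i + m\<^sub>i\<close>
gets to the \<open>i\<close>-th inverse from the right end uses that the \<open>C\<^sub>j\<close> commute with each other.
\<close>
lemma F_C_coeff_bump:
  fixes A B :: "complex^'r^'r" and C :: "'n::{finite,linorder} \<Rightarrow> complex^'r^'r"
  assumes inv: "\<And>i k::nat. invertible (C i + mat (of_nat k))"
    and CC: "\<And>i j. C i ** C j = C j ** C i"
    and CB: "\<And>j. C j ** B = B ** C j"
  defines "N \<equiv> \<lambda>m. \<Sum>j\<in>UNIV. m j"
  shows "pderiv_coeff i (F_C_coeff A B C) m ** (C i + mat (of_nat (m i)))
    = (A + mat (of_nat (N m))) ** F_C_coeff A B C m ** (B + mat (of_nat (N m)))"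
proof -
  define D where "D = (\<lambda>m j. matrix_inv (mat_pochhammer (C j) (m j)))"
  define K where "K = C i + mat (of_nat (m i))"
  have poch_D: "X ** D m j = D m j ** X" if "X ** C j = C j ** X" for X m j
    unfolding D_def using that
    by (intro commute_matrix_inv invertible_mat_pochhammer inv commute_mat_pochhammer)
  have D_K: "ordered_mat_prod (D (bump i m)) ** K = ordered_mat_prod (D m)"
    unfolding ordered_mat_prod_def
  proof (rule foldr_mult_absorb)
    show "D (bump i m) i ** K = D m i"
      unfolding D_def K_def bump_apply using inv_mat_pochhammer_Suc[OF inv] by simp
    show "K ** D m j = D m j ** K" for j
      unfolding K_def by (intro poch_D commute_add_scalar[symmetric] CC)
  qed (auto simp: D_def bump_apply)
  have B_D: "(B + mat (of_nat (N m))) ** ordered_mat_prod (D m)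
      = ordered_mat_prod (D m) ** (B + mat (of_nat (N m)))"
    unfolding ordered_mat_prod_def
    by (intro commute_foldr_mult poch_D commute_add_scalar[symmetric] CB)
  have A_A: "(A + mat (of_nat (N m))) ** mat_pochhammer A (N m)
      = mat_pochhammer A (N m) ** (A + mat (of_nat (N m)))"
    by (intro commute_mat_pochhammer commute_add_scalar[symmetric]) simp
  have scal: "of_nat (Suc (m i)) * inverse (\<Prod>j\<in>UNIV. fact (bump i m j) :: complex)
      = inverse (\<Prod>j\<in>UNIV. fact (m j))"
    by (simp add: prod_fact_bump field_simps del: of_nat_Suc)
  let ?A = "A + mat (of_nat (N m))" and ?B = "B + mat (of_nat (N m))"
    and ?PA = "mat_pochhammer A (N m)" and ?PB = "mat_pochhammer B (N m)"
  have "(?PA ** ?A) ** (?PB ** ?B) ** ordered_mat_prod (D (bump i m)) ** K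
      = (?A ** ?PA) ** ?PB ** (?B ** ordered_mat_prod (D m))"
    by (simp add: A_A D_K[symmetric] matrix_mul_assoc)
  also have "\<dots> = ?A ** (?PA ** ?PB ** ordered_mat_prod (D m)) ** ?B"
    by (simp add: B_D matrix_mul_assoc)
  finally have "(?PA ** ?A) ** (?PB ** ?B) ** ordered_mat_prod (D (bump i m)) ** K
      = ?A ** (?PA ** ?PB ** ordered_mat_prod (D m)) ** ?B" .
  then show ?thesis
    unfolding pderiv_coeff_def F_C_coeff_def sum_bump K_def[symmetric] cscale_algebra cscale_mult
      mat_pochhammer.simps scal
    by (simp add: D_def N_def)
qed

section \<open>The region of absolute convergence\<close>

text \<open>
Move every coordinate of \<open>x\<close> radially outward by the same small amount. The resulting point \<open>y\<close> still
lies in the region, and since the norm of a term only grows with the moduli of the coordinates, the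
series converges on the whole open polydisc with radii \<open>\<bar>y\<^sub>i\<bar>\<close>, which contains \<open>x\<close>.
\<close>
lemma interior_F_C_abs_conv_region_polydisc:
  fixes C :: "'n::{finite,linorder} \<Rightarrow> complex^'r^'r"
  assumes "x \<in> interior (F_C_abs_conv_region A B C)"
  obtains \<rho> where "x \<in> polydisc \<rho>" and "power_series_on \<rho> (F_C_coeff A B C) (F_C A B C)"
proof -
  obtain e where e: "e > 0" "ball x e \<subseteq> F_C_abs_conv_region A B C"
    using assms mem_interior by blast
  define d where "d = e / (2 * real CARD('n))"
  have d: "d > 0" using e by (simp add: d_def)
  \<comment> \<open>A coordinate that vanishes has no radial direction; any unit serves.\<close>
  define u where "u = (\<lambda>i. if x $ i = 0 then 1 else sgn (x $ i))"
  define y where "y = (\<chi> i. x $ i + of_real d * u i)"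
  have u: "norm (u i) = 1" for i by (simp add: u_def norm_sgn)
  have yi: "norm (y $ i) = norm (x $ i) + d" for i
  proof -
    have "x $ i + of_real d * u i = of_real (norm (x $ i) + d) * u i"
      by (auto simp: u_def sgn_eq algebra_simps)
    then show ?thesis using d by (simp add: y_def norm_mult u del: of_real_add)
  qed
  have "dist x y \<le> (\<Sum>i\<in>UNIV. norm ((x - y) $ i))"
    unfolding dist_norm norm_vec_def[of "x - y"] by (rule L2_set_le_sum) simp
  also have "\<dots> = real CARD('n) * d"
    using d by (simp add: y_def norm_mult u)
  also have "\<dots> < e" using e by (simp add: d_def)
  finally have y: "(\<lambda>m. norm (F_C_term A B C y m)) summable_on UNIV"
    using e by (auto simp: F_C_abs_conv_region_def)
  define \<rho> where "\<rho> = (\<lambda>i. norm (y $ i))"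
  have "x \<in> polydisc \<rho>" using d by (simp add: polydisc_def \<rho>_def yi)
  moreover have "power_series_on \<rho> (F_C_coeff A B C) (F_C A B C)"
    unfolding power_series_on_def
  proof
    fix w assume w: "w \<in> polydisc \<rho>"
    have "(\<lambda>m. F_C_term A B C w m $ a $ b) summable_on UNIV" for a b
      unfolding summable_on_iff_abs_summable_on_complex
    proof (rule Infinite_Sum.abs_summable_on_comparison_test'[OF y])
      fix m
      have "norm (monomial w m) \<le> norm (monomial y m)"
        by (rule norm_monomial_mono) (use w in \<open>auto simp: polydisc_def \<rho>_def intro: less_imp_le\<close>)
      then have "norm (F_C_term A B C w m $ a $ b) \<le> norm (F_C_term A B C y m $ a $ b)"
        by (simp add: F_C_term_eq cscale_nth norm_mult mult_right_mono)
      also have "\<dots> \<le> norm (F_C_term A B C y m)"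
        by (meson Finite_Cartesian_Product.norm_nth_le order_trans)
      finally show "norm (F_C_term A B C w m $ a $ b) \<le> norm (F_C_term A B C y m)" .
    qed
    then have "(F_C_term A B C w has_sum (\<chi> a b. \<Sum>\<^sub>\<infinity>m. F_C_term A B C w m $ a $ b)) UNIV"
      unfolding has_sum_matrix_iff by simp
    then have "(F_C_term A B C w has_sum F_C A B C w) UNIV"
      unfolding F_C_def by (simp add: infsumI)
    then show "((\<lambda>m. monomial w m *\<^sub>C F_C_coeff A B C m) has_sum F_C A B C w) UNIV"
      by (simp flip: F_C_term_eq)
  qed
  ultimately show ?thesis using that by blast
qed

section \<open>The differential equations\<close>

theorem theorem3p3:
  fixes A B :: "complex^'r^'r"
    and C :: "'n::{finite,linorder} \<Rightarrow> complex^'r^'r"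
  assumes "\<And>i k::nat. invertible (C i + mat (of_nat k))"
    and "\<And>i j. C i ** C j = C j ** C i"
    and "\<And>j. C j ** B = B ** C j"
  shows "let U = F_C A B C in
    \<forall>x \<in> interior (F_C_abs_conv_region A B C).
      (\<forall>i. partially_differentiable i U x) \<and>
      (\<forall>i j. partially_differentiable i (partial_deriv j U) x) \<and>
      (\<forall>i. (x $ i * (1 - x $ i)) *\<^sub>C partial_deriv2 i i U x
          - (\<Sum>j\<in>UNIV - {i}. (x $ j)\<^sup>2 *\<^sub>C partial_deriv2 j j U x)
          - 2 *\<^sub>C (\<Sum>(p, q)\<in>{(p, q). p < q}. (x $ p * x $ q) *\<^sub>C partial_deriv2 p q U x)
          - (A + mat 1) ** (\<Sum>j\<in>UNIV. x $ j *\<^sub>C partial_deriv j U x)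
          + partial_deriv i U x ** C i
          - (\<Sum>j\<in>UNIV. x $ j *\<^sub>C partial_deriv j U x) ** B
          - A ** U x ** B = 0)"
proof -
  let ?U = "F_C A B C" and ?T = "F_C_coeff A B C"
  have "(\<forall>i. partially_differentiable i ?U x) \<and>
      (\<forall>i j. partially_differentiable i (partial_deriv j ?U) x) \<and>
      (\<forall>i. (x $ i * (1 - x $ i)) *\<^sub>C partial_deriv2 i i ?U x
          - (\<Sum>j\<in>UNIV - {i}. (x $ j)\<^sup>2 *\<^sub>C partial_deriv2 j j ?U x)
          - 2 *\<^sub>C (\<Sum>(p, q)\<in>{(p, q). p < q}. (x $ p * x $ q) *\<^sub>C partial_deriv2 p q ?U x)
          - (A + mat 1) ** (\<Sum>j\<in>UNIV. x $ j *\<^sub>C partial_deriv j ?U x)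
          + partial_deriv i ?U x ** C i
          - (\<Sum>j\<in>UNIV. x $ j *\<^sub>C partial_deriv j ?U x) ** B
          - A ** ?U x ** B = 0)"
    if x_in: "x \<in> interior (F_C_abs_conv_region A B C)" for x
  proof -
    obtain \<rho> where x: "x \<in> polydisc \<rho>" and U: "power_series_on \<rho> ?T ?U"
      using interior_F_C_abs_conv_region_polydisc[OF x_in] .
    note dU = power_series_on_partial_deriv(2)[OF U]
    define E where "E = (\<Sum>j\<in>UNIV. x $ j *\<^sub>C partial_deriv j ?U x)"
    define Q where "Q = (\<Sum>(p, q)\<in>{(p, q). p < q}. (x $ p * x $ q) *\<^sub>C partial_deriv2 p q ?U x)"
    define S where "S = (\<Sum>j\<in>UNIV. (x $ j)\<^sup>2 *\<^sub>C partial_deriv2 j j ?U x) + 2 *\<^sub>C Q"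
    define N where "N = (\<lambda>m :: 'n \<Rightarrow> nat. of_nat (\<Sum>j\<in>UNIV. m j) :: complex)"
    have hU: "((\<lambda>m. monomial x m *\<^sub>C ?T m) has_sum ?U x) UNIV"
      using U x by (simp add: power_series_on_def)
    have hE: "((\<lambda>m. monomial x m *\<^sub>C (N m *\<^sub>C ?T m)) has_sum E) UNIV"
      unfolding N_def E_def by (rule has_sum_euler[OF U x])
    have hS: "((\<lambda>m. monomial x m *\<^sub>C ((N m * N m - N m) *\<^sub>C ?T m)) has_sum S) UNIV"
      unfolding N_def S_def Q_def by (rule has_sum_euler2[OF U x])
    have "((\<lambda>m. monomial x m *\<^sub>C ((N m * N m - N m) *\<^sub>C ?T m)
        + (A + mat 1) ** (monomial x m *\<^sub>C (N m *\<^sub>C ?T m))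
        + (monomial x m *\<^sub>C (N m *\<^sub>C ?T m)) ** B
        + A ** (monomial x m *\<^sub>C ?T m) ** B)
        has_sum S + (A + mat 1) ** E + E ** B + A ** ?U x ** B) UNIV"
      by (intro has_sum_add hS hE hU has_sum_bounded_linear[OF bounded_linear_matrix_ops(2)]
          has_sum_bounded_linear[OF bounded_linear_matrix_ops(3)])
    also have "(\<lambda>m. monomial x m *\<^sub>C ((N m * N m - N m) *\<^sub>C ?T m)
        + (A + mat 1) ** (monomial x m *\<^sub>C (N m *\<^sub>C ?T m))
        + (monomial x m *\<^sub>C (N m *\<^sub>C ?T m)) ** B
        + A ** (monomial x m *\<^sub>C ?T m) ** B)
      = (\<lambda>m. monomial x m *\<^sub>C ((A + mat (N m)) ** ?T m ** (B + mat (N m))))"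
      by (simp add: fun_eq_iff matrix_add_ldistrib matrix_add_rdistrib mult_mat_scalar cscale_mult
          cscale_algebra mult_ac)
    finally have rhs: "((\<lambda>m. monomial x m *\<^sub>C ((A + mat (N m)) ** ?T m ** (B + mat (N m))))
        has_sum S + (A + mat 1) ** E + E ** B + A ** ?U x ** B) UNIV" .
    \<comment> \<open>The terms that lower the degree by one stand on the left, those that keep it on the right.\<close>
    have eq: "x $ i *\<^sub>C partial_deriv2 i i ?U x + partial_deriv i ?U x ** C i
        = S + (A + mat 1) ** E + E ** B + A ** ?U x ** B" for i
    proof -
      have "((\<lambda>m. monomial x m *\<^sub>C pderiv_coeff i ?T m) has_sum partial_deriv i ?U x) UNIV"
        using dU x by (simp add: power_series_on_def)
      then have "((\<lambda>m. monomial x m *\<^sub>C (of_nat (m i) *\<^sub>C pderiv_coeff i ?T m)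
          + (monomial x m *\<^sub>C pderiv_coeff i ?T m) ** C i)
          has_sum x $ i *\<^sub>C partial_deriv2 i i ?U x + partial_deriv i ?U x ** C i) UNIV"
        unfolding partial_deriv2_def
        by (intro has_sum_add has_sum_x_partial_deriv[OF dU x]
            has_sum_bounded_linear[OF bounded_linear_matrix_ops(3)])
      also have "(\<lambda>m. monomial x m *\<^sub>C (of_nat (m i) *\<^sub>C pderiv_coeff i ?T m)
          + (monomial x m *\<^sub>C pderiv_coeff i ?T m) ** C i)
        = (\<lambda>m. monomial x m *\<^sub>C (pderiv_coeff i ?T m ** (C i + mat (of_nat (m i)))))"
        by (simp add: fun_eq_iff matrix_add_ldistrib mult_mat_scalar cscale_mult cscale_algebra)
      also have "\<dots> = (\<lambda>m. monomial x m *\<^sub>C ((A + mat (N m)) ** ?T m ** (B + mat (N m))))"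
        unfolding N_def using F_C_coeff_bump[of C B i A, OF assms] by presburger
      finally show ?thesis using rhs by (rule has_sum_unique)
    qed
    have "(x $ i * (1 - x $ i)) *\<^sub>C partial_deriv2 i i ?U x
          - (\<Sum>j\<in>UNIV - {i}. (x $ j)\<^sup>2 *\<^sub>C partial_deriv2 j j ?U x) - 2 *\<^sub>C Q
          - (A + mat 1) ** E + partial_deriv i ?U x ** C i - E ** B - A ** ?U x ** B = 0" for i
    proof -
      have split: "(x $ i * (1 - x $ i)) *\<^sub>C partial_deriv2 i i ?U x
          - (\<Sum>j\<in>UNIV - {i}. (x $ j)\<^sup>2 *\<^sub>C partial_deriv2 j j ?U x) - 2 *\<^sub>C Q
          = x $ i *\<^sub>C partial_deriv2 i i ?U x - S"
        unfolding S_def by (simp add: sum.remove[of UNIV i] right_diff_distrib cscale_algebra power2_eq_square)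
      show ?thesis unfolding split using eq[of i] by (simp add: algebra_simps)
    qed
    then show ?thesis
      unfolding E_def Q_def
      using power_series_on_partial_deriv(1)[OF U x] power_series_on_partial_deriv(1)[OF dU x]
      by blast
  qed
  then show ?thesis unfolding Let_def by blast
qed

end
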